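(* Let $(X,d)$ be a nonempty metric space and let $S$ be a nonempty subset of $F_{USC}(X)$. Let $u\in S$ and let $\{u_n\}_{n\ge1}$ be a sequence in $S$. Then the following properties are equivalent. (i) $H_{\rm end}(u_n,u)\to0$ as $n\to\infty$. (ii) $\lim_{n\to\infty}^{(\Gamma)}u_n=u$, and $\{u_n: n=1,2,\ldots\}$ is a relatively compact set in $(F_{USC}(X),H_{\rm end})$. (iii) $\lim_{n\to\infty}^{(\Gamma)}u_n=u$, and $\{u_n: n=1,2,\ldots\}$ is a relatively compact set in $(S,H_{\rm end})$. (iv) $\lim_{n\to\infty}^{(\Gamma)}u_n=u$, and $\{u_n: n=1,2,\ldots\}\cup\{u\}$ is a compact set in $(S,H_{\rm end})$. (v) $\lim_{n\to\infty}^{(\Gamma)}u_n=u$, and $\{u_n: n=1,2,\ldots\}\cup\{u\}$ is a compact set in $(F_{USC}(X),H_{\rm end})$.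
   Context: A fuzzy set in $X$ is a function $u:X\to[0,1]$. For $\alpha\in(0,1]$, $[u]_\alpha=\{x\in X: u(x)\ge\alpha\}$, and $[u]_0=\overline{\{x\in X: u(x)>0\}}$ (closure in $X$). $F_{USC}(X)$ is the set of fuzzy sets $u$ in $X$ such that $[u]_\alpha$ is closed (possibly empty) for all $\alpha\in[0,1]$ (the upper semicontinuous fuzzy sets). $X\times[0,1]$ carries the metric $\overline d((x,\alpha),(y,\beta))=d(x,y)+|\alpha-\beta|$. The endograph of $u$ is ${\rm end}\,u=\{(x,t)\in X\times[0,1]: u(x)\ge t\}$; for $u\in F_{USC}(X)$ it is a nonempty closed set. For nonempty closed $A,B\subseteq X\times[0,1]$, $H(A,B)=\max\{\sup_{a\in A}\inf_{b\in B}\overline d(a,b),\ \sup_{b\in B}\inf_{a\in A}\overline d(a,b)\}$. The endograph metric on $F_{USC}(X)$ and its subsets is $H_{\rm end}(u,v)=H({\rm end}\,u,{\rm end}\,v)$. For sets $C_n$ in a metric space $Z$: $\liminf_n C_n=\{z: z=\lim_n z_n\text{ for some }z_n\in C_n\}$, and $\limsup_n C_n=\{z: z=\lim_j z_{n_j}\text{ for some subsequence }n_1<n_2<\cdots\text{ and }z_{n_j}\in C_{n_j}\}$; $\{C_n\}$ Kuratowski converges to $C$ if $C=\liminf_n C_n=\limsup_n C_n$. $\lim^{(\Gamma)}_{n\to\infty}u_n=u$ ($\Gamma$-convergence) means that $\{{\rm end}\,u_n\}$ Kuratowski converges to ${\rm end}\,u$ in $(X\times[0,1],\overline d)$. A subset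 $A$ of a metric space $Z$ is relatively compact in $Z$ if its closure in $Z$ is compact. *)

theory Defs
  imports "HOL-Analysis.Analysis"
begin

definition fuzzy_sets :: "('a \<Rightarrow> real) set" where
  "fuzzy_sets = {u. \<forall>x. u x \<in> {0..1}}"

definition level_cut :: "('a::metric_space \<Rightarrow> real) \<Rightarrow> real \<Rightarrow> 'a set" where
  "level_cut u \<alpha> = (if \<alpha> = 0 then closure {x. 0 < u x} else {x. \<alpha> \<le> u x})"

definition F_USC :: "('a::metric_space \<Rightarrow> real) set" where
  "F_USC = {u \<in> fuzzy_sets. \<forall>\<alpha>\<in>{0..1}. closed (level_cut u \<alpha>)}"

(* The product type already carries the Euclidean product metric; the metric used here is the
   sum metric, so it is kept as a separate function on the carrier UNIV \<times> {0..1}. *)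
definition dbar :: "'a::metric_space \<times> real \<Rightarrow> 'a \<times> real \<Rightarrow> real" where
  "dbar p q = dist (fst p) (fst q) + \<bar>snd p - snd q\<bar>"

definition endograph :: "('a \<Rightarrow> real) \<Rightarrow> ('a \<times> real) set" where
  "endograph u = {(x, t) \<in> UNIV \<times> {0..1}. t \<le> u x}"

(* The Hausdorff distance may be infinite for general nonempty closed sets,
   hence the values in [0,\<infinity>]. *)
definition hausdorff_edist :: "('b \<Rightarrow> 'b \<Rightarrow> real) \<Rightarrow> 'b set \<Rightarrow> 'b set \<Rightarrow> ennreal" where
  "hausdorff_edist d A B =
     max (SUP a\<in>A. INF b\<in>B. ennreal (d a b)) (SUP b\<in>B. INF a\<in>A. ennreal (d a b))"

(* For fuzzy sets the Hausdorff distance of endographs is at most 1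
   (lemma hausdorff_edist_endograph_le_1), so nothing is lost by enn2real. *)
definition H_end :: "('a::metric_space \<Rightarrow> real) \<Rightarrow> ('a \<Rightarrow> real) \<Rightarrow> real" where
  "H_end u v = enn2real (hausdorff_edist dbar (endograph u) (endograph v))"

definition set_liminf :: "'b topology \<Rightarrow> (nat \<Rightarrow> 'b set) \<Rightarrow> 'b set" where
  "set_liminf T C = {z. \<exists>zs. (\<forall>n. zs n \<in> C n) \<and> limitin T zs z sequentially}"

definition set_limsup :: "'b topology \<Rightarrow> (nat \<Rightarrow> 'b set) \<Rightarrow> 'b set" where
  "set_limsup T C =
     {z. \<exists>r zs. strict_mono r \<and> (\<forall>j::nat. zs j \<in> C (r j)) \<and> limitin T zs z sequentially}"

definition kuratowski_converges :: "'b topology \<Rightarrow> (nat \<Rightarrow> 'b set) \<Rightarrow> 'b set \<Rightarrow> bool" where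
  "kuratowski_converges T C D \<longleftrightarrow> D = set_liminf T C \<and> D = set_limsup T C"

definition gamma_converges ::
    "(nat \<Rightarrow> 'a::metric_space \<Rightarrow> real) \<Rightarrow> ('a \<Rightarrow> real) \<Rightarrow> bool" where
  "gamma_converges us u \<longleftrightarrow>
     kuratowski_converges (Metric_space.mtopology (UNIV \<times> {0..1}) dbar)
       (\<lambda>n. endograph (us n)) (endograph u)"

definition relatively_compactin :: "'b topology \<Rightarrow> 'b set \<Rightarrow> bool" where
  "relatively_compactin T A \<longleftrightarrow> A \<subseteq> topspace T \<and> compactin T (T closure_of A)"

(* The topology of the metric space (S, H_end), see Metric_space_H_end. *)
definition H_end_topology :: "('a::metric_space \<Rightarrow> real) set \<Rightarrow> ('a \<Rightarrow> real) topology" where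
  "H_end_topology S = Metric_space.mtopology S H_end"


lemma Metric_space_dbar: "Metric_space (UNIV \<times> {0..1}) dbar"
proof
  fix p q r :: "'a \<times> real"
  show "0 \<le> dbar p q" "dbar p q = dbar q p"
    by (auto simp: dbar_def dist_commute)
  show "dbar p r \<le> dbar p q + dbar q r"
    using dist_triangle[of "fst p" "fst r" "fst q"] by (simp add: dbar_def)
  show "(dbar p q = 0) = (p = q)"
    by (auto simp: dbar_def prod_eq_iff add_nonneg_eq_0_iff)
qed

lemma hausdorff_edist_commute:
  assumes "\<And>x y. d x y = d y x"
  shows "hausdorff_edist d A B = hausdorff_edist d B A"
  using assms by (simp add: hausdorff_edist_def max.commute)

lemma INF_const_add_le:
  fixes c :: ennreal
  shows "(INF x\<in>C. c + f x) \<le> c + (INF x\<in>C. f x)"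
proof (rule ennreal_le_epsilon)
  fix e :: real assume "c + (INF x\<in>C. f x) < top" and e: "0 < e"
  then have "(INF x\<in>C. f x) < (INF x\<in>C. f x) + ennreal e"
    by (cases "INF x\<in>C. f x") (auto simp: ennreal_plus[symmetric] ennreal_less_iff simp del: ennreal_plus)
  then obtain k where k: "k \<in> C" "f k < (INF x\<in>C. f x) + ennreal e"
    unfolding INF_less_iff by blast
  have "(INF x\<in>C. c + f x) \<le> c + f k" by (rule INF_lower[OF k(1)])
  also have "\<dots> \<le> c + ((INF x\<in>C. f x) + ennreal e)"
    by (intro add_left_mono less_imp_le k)
  finally show "(INF x\<in>C. c + f x) \<le> c + (INF x\<in>C. f x) + ennreal e"
    by (simp only: add.assoc)
qed

lemma excess_triangle:
  fixes d :: "'b \<Rightarrow> 'b \<Rightarrow> real"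
  assumes nn: "\<And>x y. 0 \<le> d x y" and tri: "\<And>x y z. d x z \<le> d x y + d y z"
    and "B \<noteq> {}"
  shows "(SUP a\<in>A. INF c\<in>C. ennreal (d a c)) \<le>
    (SUP a\<in>A. INF b\<in>B. ennreal (d a b)) + (SUP b\<in>B. INF c\<in>C. ennreal (d b c))"
    (is "_ \<le> ?AB + ?BC")
proof (rule SUP_least)
  fix a assume a: "a \<in> A"
  have step: "(INF c\<in>C. ennreal (d a c)) \<le> ennreal (d a b) + ?BC" if b: "b \<in> B" for b
  proof (cases "C = {}")
    case True
    then have "(INF c\<in>C. ennreal (d b c)) = top" by simp
    then have "top \<le> ?BC"
      using SUP_upper[OF b, of "\<lambda>b. INF c\<in>C. ennreal (d b c)"] by (simp only:)
    then have "?BC = top" by (simp only: top_unique)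
    then show ?thesis by (simp only: add_top_right_ennreal top_greatest)
  next
    case False
    have "(INF c\<in>C. ennreal (d a c)) \<le> (INF c\<in>C. ennreal (d a b) + ennreal (d b c))"
      by (intro INF_mono') (simp add: ennreal_plus[symmetric] nn tri ennreal_leI del: ennreal_plus)
    also have "\<dots> \<le> ennreal (d a b) + (INF c\<in>C. ennreal (d b c))"
      by (rule INF_const_add_le)
    also have "\<dots> \<le> ennreal (d a b) + ?BC"
      by (intro add_left_mono SUP_upper b)
    finally show ?thesis .
  qed
  have "(INF c\<in>C. ennreal (d a c)) \<le> (INF b\<in>B. ?BC + ennreal (d a b))"
    using step by (intro INF_greatest) (simp add: add.commute)
  also have "\<dots> \<le> ?BC + (INF b\<in>B. ennreal (d a b))"
    by (rule INF_const_add_le)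
  also have "\<dots> \<le> ?BC + ?AB"
    by (intro add_left_mono SUP_upper a)
  finally show "(INF c\<in>C. ennreal (d a c)) \<le> ?AB + ?BC" by (simp add: add.commute)
qed

lemma hausdorff_edist_triangle:
  assumes nn: "\<And>x y. 0 \<le> d x y" and com: "\<And>x y. d x y = d y x"
    and tri: "\<And>x y z. d x z \<le> d x y + d y z" and "B \<noteq> {}"
  shows "hausdorff_edist d A C \<le> hausdorff_edist d A B + hausdorff_edist d B C"
proof -
  define e where "e A B = (SUP a\<in>A. INF b\<in>B. ennreal (d a b))" for A B
  have h: "hausdorff_edist d A B = max (e A B) (e B A)" for A B
    unfolding hausdorff_edist_def e_def by (subst (2) com) simp
  have "e A C \<le> e A B + e B C" "e C A \<le> e C B + e B A"
    unfolding e_def by (rule excess_triangle[OF nn tri \<open>B \<noteq> {}\<close>])+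
  moreover have "e A B + e B C \<le> max (e A B) (e B A) + max (e B C) (e C B)"
    by (intro add_mono max.cobounded1)
  moreover have "e C B + e B A \<le> max (e A B) (e B A) + max (e B C) (e C B)"
    by (subst add.commute) (intro add_mono max.cobounded2)
  ultimately show ?thesis
    unfolding h max.bounded_iff by (blast intro: order_trans)
qed

lemma endograph_zero: "u \<in> fuzzy_sets \<Longrightarrow> (x, 0) \<in> endograph u"
  by (auto simp: fuzzy_sets_def endograph_def)

lemma hausdorff_edist_endograph_le_1:
  assumes "u \<in> fuzzy_sets" "v \<in> fuzzy_sets"
  shows "hausdorff_edist dbar (endograph u) (endograph v) \<le> 1"
proof -
  have "(SUP a\<in>endograph u. INF b\<in>endograph v. ennreal (dbar a b)) \<le> 1"
    if "v \<in> fuzzy_sets" for u v :: "'a \<Rightarrow> real"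
  proof (rule SUP_least)
    fix a assume a: "a \<in> endograph u"
    have "(INF b\<in>endograph v. ennreal (dbar a b)) \<le> ennreal (dbar a (fst a, 0))"
      by (rule INF_lower) (rule endograph_zero[OF that])
    also have "\<dots> \<le> 1"
      using a by (auto simp: dbar_def endograph_def)
    finally show "(INF b\<in>endograph v. ennreal (dbar a b)) \<le> 1" .
  qed
  from this[OF assms(1), of v] this[OF assms(2), of u] show ?thesis
    unfolding hausdorff_edist_def
    by (simp add: dbar_def dist_commute abs_minus_commute)
qed

lemma H_end_eq_0_imp_le:
  assumes "u \<in> F_USC" "v \<in> F_USC" "H_end u v = 0"
  shows "u x \<le> v x"
proof (rule ccontr)
  assume "\<not> u x \<le> v x"
  then obtain s where s: "v x < s" "s < u x" using dense[of "v x" "u x"] by auto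
  have uv: "u \<in> fuzzy_sets" "v \<in> fuzzy_sets" using assms by (auto simp: F_USC_def)
  have s01: "0 < s" "s \<le> 1" "u x \<le> 1"
    using uv s unfolding fuzzy_sets_def atLeastAtMost_iff mem_Collect_eq
    by (meson le_less_trans less_le_trans less_imp_le)+
  have "closed {y. s \<le> v y}"
  proof -
    have "closed (level_cut v s)" using assms(2) s01 by (simp add: F_USC_def)
    then show ?thesis using s01 by (simp add: level_cut_def)
  qed
  then have "open {y. v y < s}" by (simp add: closed_def Compl_eq not_le)
  then obtain r where r: "r > 0" "\<And>y. dist y x < r \<Longrightarrow> v y < s"
    using s unfolding open_dist by blast
  have "hausdorff_edist dbar (endograph u) (endograph v) = 0"
    using assms(3) hausdorff_edist_endograph_le_1[OF uv]
    unfolding H_end_def enn2real_eq_0_iff by (metis ennreal_one_neq_top top_unique)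
  then have "(SUP a\<in>endograph u. INF b\<in>endograph v. ennreal (dbar a b)) = 0"
    unfolding hausdorff_edist_def by (simp only: max_def split: if_splits) auto
  moreover have "(x, u x) \<in> endograph u"
    using uv by (auto simp: fuzzy_sets_def endograph_def)
  ultimately have "(INF b\<in>endograph v. ennreal (dbar (x, u x) b)) = 0"
    using SUP_upper[of "(x, u x)" "endograph u" "\<lambda>a. INF b\<in>endograph v. ennreal (dbar a b)"]
    by (simp only: le_zero_eq)
  also have "0 < ennreal (min r (u x - s))" using r s by simp
  finally obtain b where b: "b \<in> endograph v" "ennreal (dbar (x, u x) b) < ennreal (min r (u x - s))"
    unfolding INF_less_iff by blast
  then have "dbar (x, u x) b < min r (u x - s)"
    by (subst (asm) ennreal_less_iff) (auto simp: dbar_def)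
  then have "dist (fst b) x < r" "s < snd b"
    using zero_le_dist[of x "fst b"] unfolding dbar_def fst_conv snd_conv dist_commute[of "fst b" x]
    by linarith+
  moreover have "snd b \<le> v (fst b)" using b by (auto simp: endograph_def)
  ultimately show False using r(2)[of "fst b"] by linarith
qed

lemma H_end_commute: "H_end u v = H_end v u"
  unfolding H_end_def by (subst hausdorff_edist_commute) (auto simp: dbar_def dist_commute)

lemma Metric_space_H_end:
  assumes "S \<subseteq> F_USC"
  shows "Metric_space S H_end"
proof
  fix u v w :: "'a \<Rightarrow> real"
  show "0 \<le> H_end u v" by (simp add: H_end_def)
  show "H_end u v = H_end v u" by (rule H_end_commute)
  have fz: "f \<in> fuzzy_sets" if "f \<in> S" for f using that assms by (auto simp: F_USC_def)
  show "(H_end u v = 0) = (u = v)" if "u \<in> S" "v \<in> S"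
  proof
    assume "H_end u v = 0"
    then show "u = v"
      using H_end_eq_0_imp_le[of u v] H_end_eq_0_imp_le[of v u] that assms
      by (auto simp: H_end_commute fun_eq_iff intro!: antisym)
  next
    assume "u = v"
    have "(INF b\<in>A. ennreal (dbar a b)) \<le> 0" "(INF b\<in>A. ennreal (dbar b a)) \<le> 0"
      if "a \<in> A" for a :: "'a \<times> real" and A
      using INF_lower[OF that, of "\<lambda>b. ennreal (dbar a b)"]
        INF_lower[OF that, of "\<lambda>b. ennreal (dbar b a)"]
      by (auto simp: dbar_def)
    then have "hausdorff_edist dbar (endograph v) (endograph v) \<le> 0"
      unfolding hausdorff_edist_def max.bounded_iff by (intro conjI SUP_least)
    then show "H_end u v = 0"
      by (simp add: H_end_def \<open>u = v\<close>)
  qed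
  show "H_end u w \<le> H_end u v + H_end v w" if S: "u \<in> S" "v \<in> S" "w \<in> S"
  proof -
    let ?h = "\<lambda>u v. hausdorff_edist dbar (endograph u) (endograph v)"
    interpret D: Metric_space "UNIV \<times> {0..1}" "dbar :: 'a \<times> real \<Rightarrow> _"
      by (rule Metric_space_dbar)
    have "?h u w \<le> ?h u v + ?h v w"
    proof (rule hausdorff_edist_triangle)
      show "endograph v \<noteq> {}" using endograph_zero[OF fz[OF S(2)]] by blast
      show "dbar p r \<le> dbar p q + dbar q r" for p q r :: "'a \<times> real"
        using dist_triangle[of "fst p" "fst r" "fst q"] by (simp add: dbar_def)
    qed (auto simp: D.commute)
    moreover have fin: "?h f g < top" if "f \<in> S" "g \<in> S" for f g
      using hausdorff_edist_endograph_le_1[OF fz fz, OF that] by (rule le_less_trans) simp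
    ultimately have "enn2real (?h u w) \<le> enn2real (?h u v + ?h v w)"
      using S by (intro enn2real_mono) simp_all
    also have "\<dots> = enn2real (?h u v) + enn2real (?h v w)"
      using fin S by (intro enn2real_plus) auto
    finally show ?thesis by (simp only: H_end_def)
  qed
qed

end

theory Submission
  imports Defs
begin

text \<open>
  A sequence that \<open>H_end\<close>-converges to \<open>u\<close> converges to \<open>u\<close> in the sense of \<open>\<Gamma>\<close>: an
  approximation that is uniform over the endographs is in particular one at every point, and the
  endograph of an upper semicontinuous fuzzy set is closed, so that no additional limit points
  appear (\<open>H_end_tendsto_imp_gamma_converges\<close>). Together with its limit such a sequence is compact
  in any metric space, and this is the strongest of the compactness conditions.

  Conversely, let the sequence be \<open>\<Gamma>\<close>-convergent to \<open>u\<close> and relatively compact. If it stayed away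
  from \<open>u\<close> along some subsequence, a further subsequence would \<open>H_end\<close>-converge to some \<open>v\<close>. By
  the first part this subsequence \<open>\<Gamma>\<close>-converges to \<open>v\<close>, but it still \<open>\<Gamma>\<close>-converges to \<open>u\<close>, and
  \<open>\<Gamma>\<close>-limits are unique, so \<open>u = v\<close>, a contradiction
  (\<open>gamma_converges_relatively_compact_imp_H_end_tendsto\<close>). Both halves apply to every ambient
  set \<open>S \<subseteq> F_USC\<close> that contains \<open>u\<close> and the sequence, and the condition \<open>H_end (us n) u \<longlonglongrightarrow> 0\<close> is
  the same for all of them; this is why the choice between \<open>S\<close> and \<open>F_USC\<close> is immaterial.
\<close>

lemma set_liminf_subset_set_limsup: "set_liminf T C \<subseteq> set_limsup T C"
proof
  fix z assume "z \<in> set_liminf T C"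
  then obtain zs where "\<forall>n. zs n \<in> C n" "limitin T zs z sequentially"
    by (auto simp: set_liminf_def)
  moreover have "strict_mono (id :: nat \<Rightarrow> nat)"
    by (simp add: strict_mono_def)
  ultimately show "z \<in> set_limsup T C"
    unfolding set_limsup_def by (intro CollectI exI[of _ id] exI[of _ zs]) simp
qed

text \<open>
  Thinning out a sequence of sets enlarges the lower limit and shrinks the upper one; between
  equal limits there is no room for either.
\<close>

lemma kuratowski_converges_subsequence:
  assumes "kuratowski_converges T C D" and r: "strict_mono r"
  shows "kuratowski_converges T (C \<circ> r) D"
proof -
  have "set_liminf T C \<subseteq> set_liminf T (C \<circ> r)"
  proof
    fix z assume "z \<in> set_liminf T C"
    then obtain zs where "\<forall>n. zs n \<in> C n" "limitin T zs z sequentially"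
      by (auto simp: set_liminf_def)
    then have "\<forall>n. (zs \<circ> r) n \<in> (C \<circ> r) n" "limitin T (zs \<circ> r) z sequentially"
      using limitin_subsequence[OF r] by auto
    then show "z \<in> set_liminf T (C \<circ> r)"
      unfolding set_liminf_def by blast
  qed
  moreover have "set_limsup T (C \<circ> r) \<subseteq> set_limsup T C"
  proof
    fix z assume "z \<in> set_limsup T (C \<circ> r)"
    then obtain q zs where "strict_mono q" "\<forall>j. zs j \<in> C ((r \<circ> q) j)" "limitin T zs z sequentially"
      by (auto simp: set_limsup_def)
    then show "z \<in> set_limsup T C"
      unfolding set_limsup_def using strict_mono_o[OF r] by blast
  qed
  ultimately show ?thesis
    using assms(1) set_liminf_subset_set_limsup[of T "C \<circ> r"]
    unfolding kuratowski_converges_def by blast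
qed

lemma gamma_converges_subsequence:
  assumes "gamma_converges us u" and "strict_mono r"
  shows "gamma_converges (us \<circ> r) u"
  using kuratowski_converges_subsequence[OF assms[unfolded gamma_converges_def]]
  by (simp add: gamma_converges_def o_def)

lemma endograph_subset_imp_le:
  assumes "u \<in> fuzzy_sets" "endograph u \<subseteq> endograph v"
  shows "u x \<le> v x"
proof -
  have "(x, u x) \<in> endograph u"
    using assms(1) by (auto simp: endograph_def fuzzy_sets_def)
  then show ?thesis
    using assms(2) by (auto simp: endograph_def)
qed

lemma gamma_converges_unique:
  assumes "gamma_converges us u" "gamma_converges us v" "u \<in> fuzzy_sets" "v \<in> fuzzy_sets"
  shows "u = v"
proof -
  have "endograph u = endograph v"
    using assms(1,2) by (simp add: gamma_converges_def kuratowski_converges_def)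
  then show ?thesis
    using endograph_subset_imp_le[OF assms(3), of v] endograph_subset_imp_le[OF assms(4), of u]
    by (simp add: fun_eq_iff order_antisym)
qed

text \<open>
  The strict inequality is what produces an actual nearby point, since the infimum in the
  Hausdorff distance need not be attained.
\<close>

lemma H_end_less_imp_near:
  assumes "u \<in> fuzzy_sets" "v \<in> fuzzy_sets" and less: "H_end u v < e" and p: "p \<in> endograph u"
  shows "\<exists>q\<in>endograph v. dbar p q < e"
proof -
  let ?h = "hausdorff_edist dbar (endograph u) (endograph v)"
  have "?h < top"
    using hausdorff_edist_endograph_le_1[OF assms(1,2)] by (rule le_less_trans) simp
  then have h: "?h = ennreal (H_end u v)"
    by (simp add: H_end_def)
  have "(INF q\<in>endograph v. ennreal (dbar p q)) \<le> ?h"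
    unfolding hausdorff_edist_def by (rule max.coboundedI1) (rule SUP_upper[OF p])
  also have "\<dots> < ennreal e"
    unfolding h using less by (subst ennreal_less_iff) (simp_all add: H_end_def)
  finally obtain q where "q \<in> endograph v" "ennreal (dbar p q) < ennreal e"
    unfolding INF_less_iff by blast
  then show ?thesis
    by (subst (asm) ennreal_less_iff) (auto simp: dbar_def)
qed

text \<open>
  This is closedness of the endograph. Above \<open>u x\<close> there is a level \<open>s < t\<close>; the sublevel set of
  \<open>s\<close> is a neighbourhood of \<open>x\<close> since \<open>[u]\<^sub>s\<close> is closed, and it keeps the endograph away from
  \<open>(x, t)\<close>.
\<close>

lemma endograph_memI_approx:
  assumes "u \<in> F_USC" and t: "t \<in> {0..1}"
    and approx: "\<And>e. 0 < e \<Longrightarrow> \<exists>q\<in>endograph u. dbar (x, t) q < e"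
  shows "(x, t) \<in> endograph u"
proof (rule ccontr)
  assume "(x, t) \<notin> endograph u"
  with t have "u x < t" by (auto simp: endograph_def)
  then obtain s where s: "u x < s" "s < t" using dense by blast
  have "0 \<le> u x" using assms(1) by (auto simp: F_USC_def fuzzy_sets_def)
  with s t have s01: "0 < s" "s \<le> 1" by auto
  have "closed (level_cut u s)" using assms(1) s01 by (simp add: F_USC_def)
  then have "open {y. u y < s}"
    using s01 by (simp add: level_cut_def closed_def Compl_eq not_le)
  then obtain r where r: "r > 0" "\<And>y. dist y x < r \<Longrightarrow> u y < s"
    using s unfolding open_dist by blast
  obtain q where q: "q \<in> endograph u" "dbar (x, t) q < min r (t - s)"
    using approx[of "min r (t - s)"] r s by auto
  then have "dist (fst q) x < r" "s < snd q"
    using zero_le_dist[of x "fst q"] unfolding dbar_def fst_conv snd_conv dist_commute[of "fst q" x]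
    by linarith+
  moreover have "snd q \<le> u (fst q)" using q by (auto simp: endograph_def)
  ultimately show False using r(2)[of "fst q"] by linarith
qed

text \<open>
  Points of the endographs of \<open>us n\<close> and of \<open>u\<close> are moved into one another at a cost that tends
  to 0: moving a point of \<open>endograph u\<close> yields an approximating sequence, and moving a convergent
  sequence into \<open>endograph u\<close> puts its limit in the closure, hence in \<open>endograph u\<close> itself.
\<close>

lemma H_end_tendsto_imp_gamma_converges:
  fixes u :: "'a::metric_space \<Rightarrow> real"
  assumes u: "u \<in> F_USC" and us: "\<And>n. us n \<in> F_USC"
    and lim: "(\<lambda>n. H_end (us n) u) \<longlonglongrightarrow> 0"
  shows "gamma_converges us u"
proof -
  interpret D: Metric_space "UNIV \<times> {0..1}" "dbar :: 'a \<times> real \<Rightarrow> _"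
    by (rule Metric_space_dbar)
  let ?C = "\<lambda>n. endograph (us n)"
  have fz: "u \<in> fuzzy_sets" "us n \<in> fuzzy_sets" for n
    using u us by (auto simp: F_USC_def)
  have sub: "endograph v \<subseteq> UNIV \<times> {0..1}" for v :: "'a \<Rightarrow> real"
    by (auto simp: endograph_def)
  have "endograph u \<subseteq> set_liminf D.mtopology ?C"
  proof
    fix z assume z: "z \<in> endograph u"
    (* The slack 1 / (n + 1) makes the bound strict and still tends to 0. *)
    let ?e = "\<lambda>n. H_end (us n) u + inverse (real (Suc n))"
    have "\<exists>q\<in>?C n. dbar z q < ?e n" for n
      by (rule H_end_less_imp_near[OF fz(1) fz(2) _ z]) (simp add: H_end_commute[of u])
    then obtain zs where zs: "\<And>n. zs n \<in> ?C n" "\<And>n. dbar z (zs n) < ?e n"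
      by metis
    have e: "?e \<longlonglongrightarrow> 0"
      using tendsto_add[OF lim LIMSEQ_inverse_real_of_nat] by simp
    have "(\<lambda>n. dbar (zs n) z) \<longlonglongrightarrow> 0"
      using zs(2) by (intro tendsto_sandwich[OF _ _ tendsto_const e] always_eventually allI)
        (auto simp: D.commute less_imp_le)
    then have "limitin D.mtopology zs z sequentially"
      unfolding D.limitin_metric_dist_null using z zs(1) sub
      by (intro conjI always_eventually allI) blast+
    with zs(1) show "z \<in> set_liminf D.mtopology ?C"
      by (auto simp: set_liminf_def)
  qed
  moreover have "set_limsup D.mtopology ?C \<subseteq> endograph u"
  proof
    fix z assume "z \<in> set_limsup D.mtopology ?C"
    then obtain r zs where r: "strict_mono r" and zs: "\<And>j. zs j \<in> ?C (r j)"
      and zlim: "limitin D.mtopology zs z sequentially"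
      by (auto simp: set_limsup_def)
    obtain x t where xt: "z = (x, t)" by (cases z)
    have t: "t \<in> {0..1}"
      using D.limitin_mspace[OF zlim] xt by auto
    have "\<exists>q\<in>endograph u. dbar (x, t) q < e" if e: "0 < e" for e
    proof -
      have "\<forall>\<^sub>F j in sequentially. dbar (zs j) z < e / 2"
        using zlim e unfolding D.limitin_metric by (auto elim!: allE[of _ "e / 2"] eventually_mono)
      moreover have "\<forall>\<^sub>F j in sequentially. H_end (us (r j)) u < e / 2"
        using order_tendstoD(2)[OF LIMSEQ_subseq_LIMSEQ[OF lim r], of "e / 2"] e
        by (simp add: o_def)
      ultimately have "\<forall>\<^sub>F j in sequentially. dbar (zs j) z < e / 2 \<and> H_end (us (r j)) u < e / 2"
        by (rule eventually_conj)
      then obtain j where j: "dbar (zs j) z < e / 2" "H_end (us (r j)) u < e / 2"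
        unfolding eventually_sequentially by blast
      obtain q where q: "q \<in> endograph u" "dbar (zs j) q < e / 2"
        using H_end_less_imp_near[OF fz(2) fz(1) j(2) zs] by blast
      have "dbar z q \<le> dbar z (zs j) + dbar (zs j) q"
        using D.triangle[of z "zs j" q] D.limitin_mspace[OF zlim] zs[of j] q(1) sub by blast
      with j(1) q show ?thesis
        unfolding xt by (intro bexI[of _ q]) (auto simp: D.commute)
    qed
    then show "z \<in> endograph u"
      unfolding xt by (rule endograph_memI_approx[OF u t])
  qed
  ultimately show ?thesis
    using set_liminf_subset_set_limsup[of D.mtopology ?C]
    unfolding gamma_converges_def kuratowski_converges_def by blast
qed

lemma limitin_H_end_topology_iff:
  assumes "S \<subseteq> F_USC" "u \<in> S" "\<And>n. us n \<in> S"
  shows "limitin (H_end_topology S) us u sequentially \<longleftrightarrow> (\<lambda>n. H_end (us n) u) \<longlonglongrightarrow> 0"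
  using assms
  by (simp add: H_end_topology_def Metric_space.limitin_metric_dist_null[OF Metric_space_H_end])

lemma relatively_compactin_if_subset_compactin:
  assumes "Hausdorff_space T" "compactin T K" "A \<subseteq> K"
  shows "relatively_compactin T A"
proof -
  have "T closure_of A \<subseteq> K"
    using assms by (intro closure_of_minimal compactin_imp_closedin)
  then have "compactin T (T closure_of A)"
    using assms(2) closed_compactin closedin_closure_of by metis
  then show ?thesis
    using assms(2,3) compactin_subset_topspace unfolding relatively_compactin_def by blast
qed

lemma gamma_converges_relatively_compact_imp_H_end_tendsto:
  fixes S :: "('a::metric_space \<Rightarrow> real) set"
  assumes S: "S \<subseteq> F_USC" and u: "u \<in> S" and us: "\<And>n. us n \<in> S"
    and gamma: "gamma_converges us u"
    and rc: "relatively_compactin (H_end_topology S) (range us)"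
  shows "(\<lambda>n. H_end (us n) u) \<longlonglongrightarrow> 0"
proof (rule ccontr)
  interpret M: Metric_space S H_end
    by (rule Metric_space_H_end[OF S])
  assume "\<not> ?thesis"
  then obtain e where e: "0 < e" "\<not> (\<forall>\<^sub>F n in sequentially. H_end (us n) u < e)"
    unfolding tendsto_iff by (auto simp: dist_real_def)
  then obtain r :: "nat \<Rightarrow> nat" where r: "strict_mono r" "\<And>n. e \<le> H_end (us (r n)) u"
    using not_eventually_sequentiallyD[OF e(2)] by (auto simp: not_less)
  have "range (us \<circ> r) \<subseteq> M.mtopology closure_of (range us)"
    using us closure_of_subset[of "range us" M.mtopology] by auto
  then obtain v q where q: "strict_mono q"
    and v: "limitin M.mtopology (us \<circ> r \<circ> q) v sequentially"
    using rc unfolding relatively_compactin_def H_end_topology_def M.compactin_sequentially by blast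
  have vS: "v \<in> S"
    using M.limitin_mspace[OF v] .
  have "(\<lambda>n. H_end ((us \<circ> r \<circ> q) n) v) \<longlonglongrightarrow> 0"
    using v unfolding M.limitin_metric_dist_null by blast
  then have "gamma_converges (us \<circ> r \<circ> q) v"
    using S vS us by (intro H_end_tendsto_imp_gamma_converges) auto
  moreover have "gamma_converges (us \<circ> r \<circ> q) u"
    using gamma r(1) q by (intro gamma_converges_subsequence)
  ultimately have "v = u"
    by (rule gamma_converges_unique) (use S vS u in \<open>auto simp: F_USC_def\<close>)
  with v e(1) have "\<forall>\<^sub>F n in sequentially. H_end (us (r (q n))) u < e"
    unfolding M.limitin_metric by (auto elim!: allE[of _ e] eventually_mono)
  then show False
    using r(2) unfolding eventually_sequentially by (meson le_refl not_le)
qed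

text \<open>
  The implications close a cycle: convergence gives compactness of the sequence with its limit,
  this gives relative compactness, and uniqueness of \<open>\<Gamma>\<close>-limits leads back to convergence.
\<close>

lemma H_end_tendsto_characterizations:
  fixes S :: "('a::metric_space \<Rightarrow> real) set"
  assumes S: "S \<subseteq> F_USC" "u \<in> S" "\<And>n. us n \<in> S"
  shows "(\<lambda>n. H_end (us n) u) \<longlonglongrightarrow> 0 \<longleftrightarrow>
      gamma_converges us u \<and> relatively_compactin (H_end_topology S) (range us)" (is "?lim \<longleftrightarrow> ?rc")
    and "(\<lambda>n. H_end (us n) u) \<longlonglongrightarrow> 0 \<longleftrightarrow>
      gamma_converges us u \<and> compactin (H_end_topology S) (range us \<union> {u})" (is "_ \<longleftrightarrow> ?c")
proof -
  interpret M: Metric_space S H_end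
    by (rule Metric_space_H_end[OF S(1)])
  have T: "H_end_topology S = M.mtopology"
    by (simp add: H_end_topology_def)
  have "?c" if ?lim
  proof
    show "gamma_converges us u"
      using S that by (intro H_end_tendsto_imp_gamma_converges) auto
    have "limitin M.mtopology us u sequentially"
      using that limitin_H_end_topology_iff[OF S] by (simp add: T)
    then have "compactin M.mtopology (insert u (range us))"
      using S(3) by (intro compactin_sequence_with_limit) auto
    then show "compactin (H_end_topology S) (range us \<union> {u})"
      by (simp add: T)
  qed
  moreover have "?rc" if ?c
    using that M.Hausdorff_space_mtopology
    by (auto simp: T intro: relatively_compactin_if_subset_compactin)
  moreover have ?lim if ?rc
    using that by (intro gamma_converges_relatively_compact_imp_H_end_tendsto[OF S]) simp_all
  ultimately show "?lim \<longleftrightarrow> ?rc" "?lim \<longleftrightarrow> ?c"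
    by blast+
qed

theorem proposition7p1:
  fixes S :: "('a::metric_space \<Rightarrow> real) set"
    and u :: "'a \<Rightarrow> real"
    and us :: "nat \<Rightarrow> 'a \<Rightarrow> real"
  assumes "S \<subseteq> F_USC" and "S \<noteq> {}"
    and "u \<in> S" and "\<And>n. us n \<in> S"
  shows
    "(((\<lambda>n. H_end (us n) u) \<longlonglongrightarrow> 0) \<longleftrightarrow>
        gamma_converges us u \<and> relatively_compactin (H_end_topology F_USC) (range us)) \<and>
     (((\<lambda>n. H_end (us n) u) \<longlonglongrightarrow> 0) \<longleftrightarrow>
        gamma_converges us u \<and> relatively_compactin (H_end_topology S) (range us)) \<and>
     (((\<lambda>n. H_end (us n) u) \<longlonglongrightarrow> 0) \<longleftrightarrow>
        gamma_converges us u \<and> compactin (H_end_topology S) (range us \<union> {u})) \<and>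
     (((\<lambda>n. H_end (us n) u) \<longlonglongrightarrow> 0) \<longleftrightarrow>
        gamma_converges us u \<and> compactin (H_end_topology F_USC) (range us \<union> {u}))"
proof -
  have F: "u \<in> F_USC" "\<And>n. us n \<in> F_USC"
    using assms by blast+
  show ?thesis
    by (intro conjI H_end_tendsto_characterizations[OF assms(1,3,4)]
        H_end_tendsto_characterizations[OF subset_refl F])
qed

end
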